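(* Let $m\ge 1$ and $n>m$ be integers. Let $M=(\mathcal{A},Q,q^{0},F,\Delta)$ be a deterministic, complete, $m$-unambiguous symbolic finite automaton over an effective Boolean algebra $\mathcal{A}$, let $T=\mathit{Minterms}(\mathit{Predicates}(M))$, and let $\delta$ be the induced transition function of $M$. Let $S=t_{1},\dots,t_{n}$ be a random event stream (each $t_i$ a random element of the domain of $\mathcal{A}$), and let $S'=X_{1},\dots,X_{n}$ be the stream induced by applying $T$ on $S$, i.e. $X_i\in T$ is the unique minterm satisfied by $t_i$. Assume that $S'$ is a (time-homogeneous) $m$-order Markov process, i.e. for all $m<i\le n$ and $a\in T$, $$P(X_{i}=a \mid X_{1},\dots,X_{i-1}) = P(X_{i}=a \mid X_{i-m},\dots,X_{i-1}),$$ where the right-hand side, as a function of $a$ and of the values of $X_{i-m},\dots,X_{i-1}$, does not depend on $i$; that is, it equals $K((X_{i-m},\dots,X_{i-1}),a)$ for a fixed transition kernel $K:T^{m}\times T\to[0,1]$, so that $K(w,a)=P(X_{m+1}=a\mid (X_{1},\dots,X_{m})=w)$ whenever $P((X_1,\dots,X_m)=w)>0$. Define $Y_{0}=q^{0}$ and $Y_{i}=\delta(Y_{i-1},t_{i})$ for $1\le i\le n$ (the sequence of states visited by $M$). Then the sequence $Y=Y_{m},\dots,Y_{n}$ is a $1$-order (time-homogeneous) Markov chain whose transition matrix is given, for states $p$ with $\delta^{-m}(p)\neq\emptyset$ and $q\in Q$, by $$\Pi(p,q)=\begin{cases} K(w_p,a) & \text{if } \delta(p,a)=q \text{ with } a\in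 T,\\ 0 & \text{if } q\notin\delta(p,T),\end{cases}$$ where $w_p\in T^m$ denotes the unique element of $\delta^{-m}(p)$ and $\delta(p,T)=\{\delta(p,a): a\in T\}$. Explicitly, for $m\le i<n$ and all $y_m,\dots,y_{i-1},p,q\in Q$ with $P(Y_m=y_m,\dots,Y_{i-1}=y_{i-1},Y_i=p)>0$, one has $P(Y_{i+1}=q\mid Y_m=y_m,\dots,Y_{i-1}=y_{i-1},Y_i=p)=\Pi(p,q)$.
   Context: A symbolic finite automaton (SFA) is a tuple $M=(\mathcal{A},Q,q^{0},F,\Delta)$, where $\mathcal{A}$ is an effective Boolean algebra with a (possibly infinite) domain of elements (here called events) and a set $\Psi_{\mathcal{A}}$ of unary predicates on the domain closed under the Boolean connectives, $Q$ is a finite set of states, $q^{0}\in Q$ is the initial state, $F\subseteq Q$ is the set of final states, and $\Delta\subseteq Q\times\Psi_{\mathcal{A}}\times Q$ is a finite set of transitions. A transition $(p,\psi,q)$ can be taken from $p$ to $q$ on reading an event $t$ iff $\psi(t)$ is true. $M$ is deterministic if distinct transitions leaving the same state have mutually exclusive guards (at most one evaluates to true on any event). $M$ is complete if for every state $p$ and every event $t$ some transition from $p$ has a guard true on $t$. $\mathit{Predicates}(M)$ is the finite set of predicates appearing as guards in $\Delta$. $\mathit{Minterms}(\mathit{Predicates}(M))$ is the finite set of maximal satisfiable Boolean combinations of these predicates, i.e. the satisfiable conjunctions containing, for each $\psi\in\mathit{Predicates}(M)$, exactly one of $\psi$, $\neg\psi$. Each event satisfies exactly one minterm, so an event stream $t_1,\dots,t_n$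 is mapped to the induced stream $X_1,\dots,X_n$ in $T=\mathit{Minterms}(\mathit{Predicates}(M))$. For $M$ deterministic and complete, $\delta(p,t)$ denotes the unique state reached from $p$ on reading the event $t$. It depends on $t$ only through the minterm $a\in T$ satisfied by $t$, so one also writes $\delta(p,a)$ for $a\in T$, and extends $\delta$ to words $a=a_1\cdots a_m\in T^m$ by reading $a_1,\dots,a_m$ successively. For $q\in Q$, $\delta^{-m}(q)=\{a\in T^{m}\mid \exists p\in Q:\ \delta(p,a)=q\}$ is the set of words of length $m$ that can lead to $q$. $M$ is $m$-unambiguous if for every $q\in Q$ the set $\delta^{-m}(q)$ contains at most one element, i.e. upon reaching a state the last $m$ minterms that evaluated to true are determined. *)

theory Defs
  imports "HOL-Probability.Probability"
begin

text \<open>A unary predicate on the event domain \<open>D\<close> is represented by its extension, a subset of \<open>D\<close>: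
  \<open>\<psi>(t)\<close> is true iff \<open>t \<in> \<psi>\<close>, and conjunction, disjunction and negation are \<open>\<inter>\<close>, \<open>\<union>\<close> and
  \<open>D - \<psi>\<close>.  Thus the predicates of a Boolean algebra with domain \<open>D\<close> form an \<^const>\<open>algebra\<close> of
  subsets of \<open>D\<close>.  Decidability of the algebra (its effectiveness) is not modelled.\<close>

record ('e, 's) sfa =
  event_domain :: "'e set"
  preds :: "'e set set"
  states :: "'s set"
  initial :: 's
  final :: "'s set"
  transitions :: "('s \<times> 'e set \<times> 's) set"

definition wf_sfa :: "('e, 's) sfa \<Rightarrow> bool" where
  "wf_sfa M \<longleftrightarrow> algebra (event_domain M) (preds M) \<and> finite (states M) \<and>
     initial M \<in> states M \<and> final M \<subseteq> states M \<and>
     finite (transitions M) \<and> transitions M \<subseteq> states M \<times> preds M \<times> states M"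

definition deterministic_sfa :: "('e, 's) sfa \<Rightarrow> bool" where
  "deterministic_sfa M \<longleftrightarrow>
     (\<forall>p \<psi> q \<psi>' q'. (p, \<psi>, q) \<in> transitions M \<longrightarrow> (p, \<psi>', q') \<in> transitions M \<longrightarrow>
        (\<psi>, q) \<noteq> (\<psi>', q') \<longrightarrow> \<psi> \<inter> \<psi>' = {})"

definition complete_sfa :: "('e, 's) sfa \<Rightarrow> bool" where
  "complete_sfa M \<longleftrightarrow>
     (\<forall>p\<in>states M. \<forall>t\<in>event_domain M. \<exists>\<psi> q. (p, \<psi>, q) \<in> transitions M \<and> t \<in> \<psi>)"

definition Predicates :: "('e, 's) sfa \<Rightarrow> 'e set set" where
  "Predicates M = {\<psi>. \<exists>p q. (p, \<psi>, q) \<in> transitions M}"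

text \<open>\<open>S\<close> is the set of predicates occurring positively in the conjunction.\<close>

definition Minterms :: "'e set \<Rightarrow> 'e set set \<Rightarrow> 'e set set" where
  "Minterms D Ps = {a. a \<noteq> {} \<and> (\<exists>S\<subseteq>Ps. a = D \<inter> (\<Inter>\<psi>\<in>S. \<psi>) \<inter> (\<Inter>\<psi>\<in>Ps - S. D - \<psi>))}"

definition minterms :: "('e, 's) sfa \<Rightarrow> 'e set set" where
  "minterms M = Minterms (event_domain M) (Predicates M)"

definition minterm_of :: "('e, 's) sfa \<Rightarrow> 'e \<Rightarrow> 'e set" where
  "minterm_of M t = (THE a. a \<in> minterms M \<and> t \<in> a)"

definition delta :: "('e, 's) sfa \<Rightarrow> 's \<Rightarrow> 'e \<Rightarrow> 's" where
  "delta M p t = (THE q. \<exists>\<psi>. (p, \<psi>, q) \<in> transitions M \<and> t \<in> \<psi>)"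

text \<open>For deterministic complete \<open>M\<close>, \<open>delta M p\<close> is constant on each minterm; \<open>delta_minterm\<close> is
  this common value.\<close>

definition delta_minterm :: "('e, 's) sfa \<Rightarrow> 's \<Rightarrow> 'e set \<Rightarrow> 's" where
  "delta_minterm M p a = (THE q. \<forall>t\<in>a. delta M p t = q)"

definition delta_word :: "('e, 's) sfa \<Rightarrow> 's \<Rightarrow> 'e set list \<Rightarrow> 's" where
  "delta_word M = foldl (delta_minterm M)"

definition words :: "'a set \<Rightarrow> nat \<Rightarrow> 'a list set" where
  "words A m = {w. set w \<subseteq> A \<and> length w = m}"

definition delta_inv :: "('e, 's) sfa \<Rightarrow> nat \<Rightarrow> 's \<Rightarrow> 'e set list set" where
  "delta_inv M m q = {w \<in> words (minterms M) m. \<exists>p\<in>states M. delta_word M p w = q}"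

definition unambiguous :: "nat \<Rightarrow> ('e, 's) sfa \<Rightarrow> bool" where
  "unambiguous m M \<longleftrightarrow>
     (\<forall>q\<in>states M. \<forall>w\<in>delta_inv M m q. \<forall>w'\<in>delta_inv M m q. w = w')"

text \<open>The event stream \<open>s\<close> is indexed from 1.\<close>

primrec run :: "('e, 's) sfa \<Rightarrow> (nat \<Rightarrow> 'e) \<Rightarrow> nat \<Rightarrow> 's" where
  "run M s 0 = initial M"
| "run M s (Suc i) = delta M (run M s i) (s (Suc i))"

definition transition_kernel :: "'w set \<Rightarrow> 'a set \<Rightarrow> ('w \<Rightarrow> 'a \<Rightarrow> real) \<Rightarrow> bool" where
  "transition_kernel W A K \<longleftrightarrow>
     (\<forall>w\<in>W. (\<forall>a\<in>A. 0 \<le> K w a \<and> K w a \<le> 1) \<and> (\<Sum>a\<in>A. K w a) = 1)"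

text \<open>\<open>X\<^sub>l, \<dots>, X\<^sub>h\<close> is a time-homogeneous Markov process of order \<open>k\<close> on the countable state
  space \<open>A\<close> with transition probabilities \<open>K\<close>; the first argument of \<open>K\<close> lists the last \<open>k\<close> values,
  oldest first.  Conditional probabilities are only constrained for pasts of positive probability.\<close>

definition markov_process ::
  "'\<omega> measure \<Rightarrow> 'a set \<Rightarrow> nat \<Rightarrow> nat \<Rightarrow> nat \<Rightarrow> (nat \<Rightarrow> '\<omega> \<Rightarrow> 'a) \<Rightarrow> ('a list \<Rightarrow> 'a \<Rightarrow> real) \<Rightarrow> bool"
where
  "markov_process P A k l h X K \<longleftrightarrow>
     (\<forall>i\<in>{l..h}. X i \<in> measurable P (count_space A)) \<and>
     (\<forall>i\<in>{l + k..h}. \<forall>x\<in>{l..<i} \<rightarrow> A. \<forall>a\<in>A.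
        \<P>(\<omega> in P. \<forall>j\<in>{l..<i}. X j \<omega> = x j) > 0 \<longrightarrow>
        \<P>(\<omega> in P. X i \<omega> = a \<bar> \<forall>j\<in>{l..<i}. X j \<omega> = x j)
          = \<P>(\<omega> in P. X i \<omega> = a \<bar> \<forall>j\<in>{i - k..<i}. X j \<omega> = x j) \<and>
        \<P>(\<omega> in P. X i \<omega> = a \<bar> \<forall>j\<in>{l..<i}. X j \<omega> = x j) = K (map x [i - k..<i]) a)"

text \<open>Used only for \<open>p\<close> with \<open>delta_inv M m p \<noteq> {}\<close>.  For \<open>m \<ge> 1\<close> and \<open>m\<close>-unambiguous \<open>M\<close>, this set is
  then a singleton and the minterm leading from \<open>p\<close> to \<open>q\<close> is unique, since two such minterms would
  give two words of length \<open>m\<close> leading to \<open>q\<close>.\<close>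

definition transition_matrix ::
  "('e, 's) sfa \<Rightarrow> nat \<Rightarrow> ('e set list \<Rightarrow> 'e set \<Rightarrow> real) \<Rightarrow> 's \<Rightarrow> 's \<Rightarrow> real"
where
  "transition_matrix M m K p q =
     (if q \<in> delta_minterm M p ` minterms M
      then K (the_elem (delta_inv M m p)) (THE a. a \<in> minterms M \<and> delta_minterm M p a = q)
      else 0)"

end

theory Submission
  imports Defs
begin

text \<open>By \<open>m\<close>-unambiguity the state \<open>Y\<^sub>i\<close> determines the last \<open>m\<close> minterms, and the minterms
  \<open>X\<^sub>1, \<dots>, X\<^sub>i\<close> determine \<open>Y\<^sub>0, \<dots>, Y\<^sub>i\<close>.  Hence every event about \<open>Y\<^sub>m, \<dots>, Y\<^sub>i\<close> that is
  contained in \<open>Y\<^sub>i = p\<close> is a finite disjoint union of cylinders \<open>X\<^sub>1 = x\<^sub>1, \<dots>, X\<^sub>i = x\<^sub>i\<close> with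
  \<open>x\<^sub>i\<^sub>-\<^sub>m\<^sub>+\<^sub>1 \<dots> x\<^sub>i = w\<^sub>p\<close>, and on each of them the next minterm is \<open>a\<close> with probability \<open>K(w\<^sub>p, a)\<close>.
  Moreover \<open>a \<mapsto> \<delta>(p, a)\<close> is injective, because two minterms leading from \<open>p\<close> to \<open>q\<close> would extend
  the last \<open>m - 1\<close> letters of \<open>w\<^sub>p\<close> to two words leading to \<open>q\<close>.\<close>

section \<open>Minterms as a finite partition of the event domain\<close>

text \<open>A point of the conjunction decides every predicate in \<open>Ps\<close>, so the positive
  set \<open>S\<close> can be read off from any single point. Existence, uniqueness and constancy of
  predicates on minterms all rest on this.\<close>

lemma mem_minterm_iff:
  assumes "S \<subseteq> Ps"
  shows "t \<in> D \<inter> (\<Inter>\<psi>\<in>S. \<psi>) \<inter> (\<Inter>\<psi>\<in>Ps - S. D - \<psi>) \<longleftrightarrow> t \<in> D \<and> S = {\<psi>\<in>Ps. t \<in> \<psi>}"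
  using assms by (simp only: Int_iff INT_iff Diff_iff mem_Collect_eq set_eq_iff subset_iff) blast

lemma Minterms_cases:
  assumes "a \<in> Minterms D Ps"
  obtains S where "S \<subseteq> Ps" "a = D \<inter> (\<Inter>\<psi>\<in>S. \<psi>) \<inter> (\<Inter>\<psi>\<in>Ps - S. D - \<psi>)"
  using assms unfolding Minterms_def by (elim CollectE conjE exE)

lemma ex1_Minterms:
  assumes "t \<in> D"
  shows "\<exists>!a. a \<in> Minterms D Ps \<and> t \<in> a"
proof
  let ?a = "\<lambda>S. D \<inter> (\<Inter>\<psi>\<in>S. \<psi>) \<inter> (\<Inter>\<psi>\<in>Ps - S. D - \<psi>)"
  let ?S = "{\<psi>\<in>Ps. t \<in> \<psi>}"
  have sub: "?S \<subseteq> Ps" by (rule Collect_restrict)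
  have t: "t \<in> ?a ?S"
    using assms unfolding mem_minterm_iff[OF sub] by simp
  have "?a ?S \<noteq> {}"
  proof
    assume "?a ?S = {}"
    then show False using t by (simp only: empty_iff)
  qed
  then have "?a ?S \<in> Minterms D Ps"
    unfolding Minterms_def by (intro CollectI conjI exI[of _ ?S] sub refl)
  then show "?a ?S \<in> Minterms D Ps \<and> t \<in> ?a ?S"
    using t by (rule conjI)
  fix a assume a: "a \<in> Minterms D Ps \<and> t \<in> a"
  then obtain S where S: "S \<subseteq> Ps" "a = ?a S"
    by (elim conjE Minterms_cases)
  have "t \<in> ?a S" using a unfolding S(2) by (rule conjunct2)
  then have "S = ?S" unfolding mem_minterm_iff[OF S(1)] by (rule conjunct2)
  then show "a = ?a ?S" using S(2) by (rule subst)
qed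

text \<open>Both points recover the same positive set \<open>S\<close>. This is what lets a whole
  minterm stand in for each of its events.\<close>

lemma Minterms_mem_iff:
  assumes "a \<in> Minterms D Ps" "t \<in> a" "t' \<in> a" "\<psi> \<in> Ps"
  shows "t \<in> \<psi> \<longleftrightarrow> t' \<in> \<psi>"
proof -
  obtain S where S: "S \<subseteq> Ps" "a = D \<inter> (\<Inter>\<psi>\<in>S. \<psi>) \<inter> (\<Inter>\<psi>\<in>Ps - S. D - \<psi>)"
    using assms(1) by (rule Minterms_cases)
  have "S = {\<psi>\<in>Ps. t \<in> \<psi>}" "S = {\<psi>\<in>Ps. t' \<in> \<psi>}"
    using assms(2,3) unfolding S(2) mem_minterm_iff[OF S(1)] by blast+
  then show ?thesis using assms(4) by blast
qed

lemma Minterms_nonempty: "a \<in> Minterms D Ps \<Longrightarrow> a \<noteq> {}"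
  unfolding Minterms_def by (elim CollectE conjE)

lemma Minterms_subset: "a \<in> Minterms D Ps \<Longrightarrow> a \<subseteq> D"
  by (erule Minterms_cases) blast

lemma finite_Minterms:
  assumes "finite Ps"
  shows "finite (Minterms D Ps)"
proof (rule finite_subset)
  let ?a = "\<lambda>S. D \<inter> (\<Inter>\<psi>\<in>S. \<psi>) \<inter> (\<Inter>\<psi>\<in>Ps - S. D - \<psi>)"
  show "Minterms D Ps \<subseteq> ?a ` Pow Ps"
  proof
    fix a assume "a \<in> Minterms D Ps"
    then obtain S where "S \<subseteq> Ps" "a = ?a S" by (rule Minterms_cases)
    then show "a \<in> ?a ` Pow Ps" by (intro image_eqI[of _ _ S] PowI)
  qed
  show "finite (?a ` Pow Ps)"
    using assms by (intro finite_imageI) simp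
qed

section \<open>The transition function on events and on minterms\<close>

locale complete_dfa =
  fixes M :: "('e, 's) sfa"
  assumes wf: "wf_sfa M" and det: "deterministic_sfa M" and compl: "complete_sfa M"
begin

lemma finite_minterms: "finite (minterms M)"
proof -
  have "Predicates M = (\<lambda>(p, \<psi>, q). \<psi>) ` transitions M"
    unfolding Predicates_def by force
  then show ?thesis
    using wf unfolding minterms_def wf_sfa_def by (simp add: finite_Minterms)
qed

lemma finite_states: "finite (states M)"
  using wf by (simp add: wf_sfa_def)

lemma minterm_of:
  assumes "t \<in> event_domain M"
  shows "minterm_of M t \<in> minterms M" "t \<in> minterm_of M t"
  using theI'[OF ex1_Minterms[OF assms, of "Predicates M"]]
  unfolding minterm_of_def minterms_def by auto

text \<open>Determinism forces two transitions from \<open>p\<close> whose guards share the event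
  \<open>t\<close> to coincide, so the description in \<open>delta\<close> is well defined.\<close>

lemma delta_eqI:
  assumes "(p, \<psi>, q) \<in> transitions M" "t \<in> \<psi>"
  shows "delta M p t = q"
  unfolding delta_def
proof (rule the_equality)
  show "\<exists>\<psi>. (p, \<psi>, q) \<in> transitions M \<and> t \<in> \<psi>" using assms by blast
  fix q' assume "\<exists>\<psi>. (p, \<psi>, q') \<in> transitions M \<and> t \<in> \<psi>"
  then show "q' = q" using det assms unfolding deterministic_sfa_def by blast
qed

lemma deltaE:
  assumes "p \<in> states M" "t \<in> event_domain M"
  obtains \<psi> where "(p, \<psi>, delta M p t) \<in> transitions M" "t \<in> \<psi>"
proof -
  obtain \<psi> q where "(p, \<psi>, q) \<in> transitions M" "t \<in> \<psi>"
    using assms compl unfolding complete_sfa_def by blast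
  then show thesis using that delta_eqI by metis
qed

lemma delta_in_states:
  assumes "p \<in> states M" "t \<in> event_domain M"
  shows "delta M p t \<in> states M"
  using deltaE[OF assms] wf unfolding wf_sfa_def by blast

text \<open>The guard enabled at \<open>t\<close> is one of the predicates of \<open>M\<close>,
  hence true on all of \<open>a\<close>: the same transition fires for every event of the
  minterm.\<close>

lemma delta_minterm_eq:
  assumes "p \<in> states M" "a \<in> minterms M" "t \<in> a"
  shows "delta_minterm M p a = delta M p t"
proof -
  have tD: "t \<in> event_domain M"
    using assms Minterms_subset unfolding minterms_def by blast
  obtain \<psi> where \<psi>: "(p, \<psi>, delta M p t) \<in> transitions M" "t \<in> \<psi>"
    using deltaE[OF assms(1) tD] .
  have "\<psi> \<in> Predicates M" using \<psi> unfolding Predicates_def by blast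
  then have "t' \<in> \<psi>" if "t' \<in> a" for t'
    using Minterms_mem_iff[OF assms(2)[unfolded minterms_def] assms(3) that] \<psi>(2) by blast
  then have const: "\<forall>t'\<in>a. delta M p t' = delta M p t"
    using delta_eqI[OF \<psi>(1)] by blast
  show ?thesis
    unfolding delta_minterm_def
  proof (rule the_equality)
    show "\<forall>t'\<in>a. delta M p t' = delta M p t" by (rule const)
    show "q = delta M p t" if "\<forall>t'\<in>a. delta M p t' = q" for q
      using that assms(3) by simp
  qed
qed

lemma delta_minterm_of:
  assumes "p \<in> states M" "t \<in> event_domain M"
  shows "delta_minterm M p (minterm_of M t) = delta M p t"
  using delta_minterm_eq assms minterm_of by blast

text \<open>Minterms are satisfiable, so some event realises \<open>a\<close> and the claim reduces
  to \<open>delta\<close>.\<close>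

lemma delta_minterm_in_states:
  assumes "p \<in> states M" "a \<in> minterms M"
  shows "delta_minterm M p a \<in> states M"
proof -
  obtain t where "t \<in> a" using assms(2) Minterms_nonempty unfolding minterms_def by blast
  moreover have "t \<in> event_domain M"
    using assms(2) \<open>t \<in> a\<close> Minterms_subset unfolding minterms_def by blast
  ultimately show ?thesis using delta_minterm_eq delta_in_states assms by metis
qed

section \<open>Runs as functions of the induced minterm stream\<close>

lemma run_in_states:
  assumes "\<And>j. j \<in> {1..k} \<Longrightarrow> s j \<in> event_domain M"
  shows "run M s k \<in> states M"
  using assms wf by (induction k) (auto simp: wf_sfa_def intro!: delta_in_states)

text \<open>Cuts a run at time \<open>k\<close>. Cutting at 0 shows that a state depends on minterms
  only; cutting \<open>m\<close> steps before the end isolates the recent word.\<close>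

lemma run_add:
  assumes "\<And>j. j \<in> {1..k + l} \<Longrightarrow> s j \<in> event_domain M"
  shows "run M s (k + l) =
    delta_word M (run M s k) (map (\<lambda>j. minterm_of M (s j)) [Suc k..<Suc (k + l)])"
  using assms
proof (induction l)
  case 0
  then show ?case by (simp add: delta_word_def)
next
  case (Suc l)
  have "run M s (k + l) \<in> states M" by (rule run_in_states) (use Suc.prems in auto)
  then show ?case
    using Suc by (simp add: delta_word_def delta_minterm_of)
qed

lemma run_cong:
  assumes "\<And>j. j \<in> {1..k} \<Longrightarrow> s j \<in> event_domain M"
    and "\<And>j. j \<in> {1..k} \<Longrightarrow> s' j \<in> event_domain M"
    and "\<And>j. j \<in> {1..k} \<Longrightarrow> minterm_of M (s j) = minterm_of M (s' j)"
  shows "run M s k = run M s' k"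
proof -
  \<comment> \<open>The bound \<open>0 + k\<close> has the shape that \<open>run_add\<close> takes
    for a run cut at time 0.\<close>
  define w where "w s = map (\<lambda>j. minterm_of M (s j)) [Suc 0..<Suc (0 + k)]" for s
  have "w s = w s'"
    unfolding w_def using assms(3) by (intro map_cong) auto
  moreover have "run M s k = delta_word M (initial M) (w s)"
    using run_add[of 0 k s] assms(1) by (simp add: w_def del: upt_Suc)
  moreover have "run M s' k = delta_word M (initial M) (w s')"
    using run_add[of 0 k s'] assms(2) by (simp add: w_def del: upt_Suc)
  ultimately show ?thesis by simp
qed

text \<open>The state visited at time \<open>k - m\<close> is a source from which the last
  \<open>m\<close> minterms lead to the current state.\<close>

lemma recent_word_in_delta_inv:
  assumes "\<And>j. j \<in> {1..k} \<Longrightarrow> s j \<in> event_domain M" and "m \<le> k"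
  shows "map (\<lambda>j. minterm_of M (s j)) [Suc k - m..<Suc k] \<in> delta_inv M m (run M s k)"
proof -
  \<comment> \<open>Truncated subtraction is harmless here because \<open>m \<le> k\<close>.\<close>
  have eqs: "k - m + m = k" "Suc (k - m) = Suc k - m" using assms(2) by auto
  have "run M s (k - m + m) =
      delta_word M (run M s (k - m)) (map (\<lambda>j. minterm_of M (s j)) [Suc (k - m)..<Suc (k - m + m)])"
    by (rule run_add) (use assms in auto)
  then have "delta_word M (run M s (k - m)) (map (\<lambda>j. minterm_of M (s j)) [Suc k - m..<Suc k]) =
      run M s k"
    unfolding eqs by (rule sym)
  moreover have "run M s (k - m) \<in> states M"
    by (rule run_in_states) (use assms in auto)
  moreover have "map (\<lambda>j. minterm_of M (s j)) [Suc k - m..<Suc k] \<in> words (minterms M) m"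
    using assms by (auto simp: words_def intro!: minterm_of(1))
  ultimately show ?thesis unfolding delta_inv_def by blast
qed

lemma delta_inv_eq_singleton:
  assumes "unambiguous m M" "p \<in> states M" "w \<in> delta_inv M m p"
  shows "delta_inv M m p = {w}"
  using assms unfolding unambiguous_def by blast

section \<open>Consequences of unambiguity for the transition matrix\<close>

lemma inj_on_delta_minterm:
  assumes "m \<ge> 1" "unambiguous m M" "p \<in> states M" "delta_inv M m p \<noteq> {}"
  shows "inj_on (delta_minterm M p) (minterms M)"
proof (rule inj_onI)
  fix a a' assume a: "a \<in> minterms M" "a' \<in> minterms M"
    and eq: "delta_minterm M p a = delta_minterm M p a'"
  obtain w p0 where w: "w \<in> words (minterms M) m" "p0 \<in> states M" "delta_word M p0 w = p"
    using assms(4) unfolding delta_inv_def by blast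
  then obtain b u where bu: "w = b # u" using assms(1) by (cases w) (auto simp: words_def)
  have b: "b \<in> minterms M" and u: "set u \<subseteq> minterms M" "length u = m - 1"
    using w(1) bu by (auto simp: words_def)
  let ?p1 = "delta_minterm M p0 b"
  have p1: "?p1 \<in> states M" "delta_word M ?p1 u = p"
    using w b bu delta_minterm_in_states by (auto simp: delta_word_def)
  \<comment> \<open>Dropping the oldest letter \<open>b\<close> makes room for \<open>c\<close>:
    from \<open>?p1\<close> the word \<open>u\<close> still leads to \<open>p\<close>, and
    \<open>delta_inv\<close> admits any state as source.\<close>
  have "u @ [c] \<in> delta_inv M m (delta_minterm M p c)" if "c \<in> minterms M" for c
    unfolding delta_inv_def words_def using that p1 u assms(1)
    by (auto simp: delta_word_def intro!: bexI[of _ ?p1])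
  then have "u @ [a] = u @ [a']"
    using a eq assms(2,3) delta_minterm_in_states unfolding unambiguous_def by metis
  then show "a = a'" by simp
qed

text \<open>Injectivity makes \<open>a\<close> the only candidate for the \<open>THE\<close> in the
  matrix entry, and unambiguity makes \<open>w\<close> the value of \<open>the_elem\<close>.\<close>

lemma transition_matrix_delta_minterm:
  assumes "m \<ge> 1" "unambiguous m M" "p \<in> states M" "w \<in> delta_inv M m p" "a \<in> minterms M"
  shows "transition_matrix M m K p (delta_minterm M p a) = K w a"
proof -
  have "inj_on (delta_minterm M p) (minterms M)"
    using inj_on_delta_minterm assms by blast
  then have "(THE b. b \<in> minterms M \<and> delta_minterm M p b = delta_minterm M p a) = a"
    using assms(5) by (intro the_equality) (auto dest: inj_onD)
  then show ?thesis
    using assms(5) delta_inv_eq_singleton[OF assms(2-4)] unfolding transition_matrix_def by simp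
qed

text \<open>Row \<open>p\<close> is the distribution \<open>K w\<close> transported along the
  injective map \<open>delta_minterm M p\<close>, with zeros at the states outside its
  image.\<close>

lemma transition_matrix_kernel:
  assumes "m \<ge> 1" "unambiguous m M"
    and K: "transition_kernel (words (minterms M) m) (minterms M) K"
  shows "transition_kernel {p \<in> states M. delta_inv M m p \<noteq> {}} (states M) (transition_matrix M m K)"
  unfolding transition_kernel_def
proof (intro ballI conjI)
  fix p assume "p \<in> {p \<in> states M. delta_inv M m p \<noteq> {}}"
  then obtain w where p: "p \<in> states M" and w: "w \<in> delta_inv M m p" by blast
  then have ww: "w \<in> words (minterms M) m" by (simp add: delta_inv_def)
  note tm = transition_matrix_delta_minterm[OF assms(1,2) p w, of _ K]
  have zero: "transition_matrix M m K p q = 0" if "q \<notin> delta_minterm M p ` minterms M" for q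
    using that by (simp add: transition_matrix_def)
  show "0 \<le> transition_matrix M m K p q" "transition_matrix M m K p q \<le> 1" for q
    using K ww tm zero[of q] unfolding transition_kernel_def
    by (cases "q \<in> delta_minterm M p ` minterms M"; auto)+
  have "(\<Sum>q\<in>states M. transition_matrix M m K p q) =
      (\<Sum>q\<in>delta_minterm M p ` minterms M. transition_matrix M m K p q)"
    using finite_states zero p delta_minterm_in_states
    by (intro sum.mono_neutral_right) auto
  also have "\<dots> = (\<Sum>a\<in>minterms M. K w a)"
    using tm inj_on_delta_minterm[OF assms(1,2) p] w by (subst sum.reindex) auto
  also have "\<dots> = 1" using K ww by (simp add: transition_kernel_def)
  finally show "(\<Sum>q\<in>states M. transition_matrix M m K p q) = 1" .
qed

end

section \<open>Cylinder events and total probability\<close>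

text \<open>A value \<open>c\<close> outside \<open>T\<close> has empty preimage, so cylinders are
  events for arbitrary prescribed values.\<close>

lemma sets_Collect_eq_count_space:
  assumes "f \<in> measurable M (count_space T)"
  shows "{\<omega>\<in>space M. f \<omega> = c} \<in> sets M"
proof (cases "c \<in> T")
  case True
  moreover have "{\<omega>\<in>space M. f \<omega> = c} = f -` {c} \<inter> space M" by blast
  ultimately show ?thesis using measurable_sets[OF assms, of "{c}"] by simp
next
  case False
  then have "{\<omega>\<in>space M. f \<omega> = c} = {}" using measurable_space[OF assms] by auto
  then show ?thesis by (simp only: sets.empty_sets)
qed

lemma sets_cylinder:
  assumes "finite J" "\<And>j. j \<in> J \<Longrightarrow> X j \<in> measurable M (count_space T)"
  shows "{\<omega>\<in>space M. \<forall>j\<in>J. X j \<omega> = x j} \<in> sets M"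
  using assms by (intro sets.sets_Collect_finite_All sets_Collect_eq_count_space)

text \<open>Law of total probability. Indexing by extensional functions keeps the family finite, and
  distinct indices differ somewhere on \<open>J\<close>, which makes their cylinders
  disjoint.\<close>

lemma (in prob_space) prob_eq_sum_cylinders:
  assumes "finite J" "finite T" "\<And>j. j \<in> J \<Longrightarrow> X j \<in> measurable M (count_space T)"
    and A: "A \<in> events"
  shows "prob A = (\<Sum>x\<in>J \<rightarrow>\<^sub>E T. prob (A \<inter> {\<omega>\<in>space M. \<forall>j\<in>J. X j \<omega> = x j}))"
proof -
  have cyl: "{\<omega>\<in>space M. \<forall>j\<in>J. X j \<omega> = x j} \<in> events" for x
    using assms(1,3) by (rule sets_cylinder)
  have "A = (\<Union>x\<in>J \<rightarrow>\<^sub>E T. A \<inter> {\<omega>\<in>space M. \<forall>j\<in>J. X j \<omega> = x j})"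
  proof
    show "A \<subseteq> (\<Union>x\<in>J \<rightarrow>\<^sub>E T. A \<inter> {\<omega>\<in>space M. \<forall>j\<in>J. X j \<omega> = x j})"
    proof
      fix \<omega> assume "\<omega> \<in> A"
      moreover then have "\<omega> \<in> space M" using A sets.sets_into_space by blast
      moreover then have "(\<lambda>j\<in>J. X j \<omega>) \<in> J \<rightarrow>\<^sub>E T"
        using measurable_space[OF assms(3)] by auto
      ultimately show "\<omega> \<in> (\<Union>x\<in>J \<rightarrow>\<^sub>E T. A \<inter> {\<omega>\<in>space M. \<forall>j\<in>J. X j \<omega> = x j})"
        by (auto intro!: bexI[of _ "\<lambda>j\<in>J. X j \<omega>"])
    qed
  qed auto
  then have "prob A = prob (\<Union>x\<in>J \<rightarrow>\<^sub>E T. A \<inter> {\<omega>\<in>space M. \<forall>j\<in>J. X j \<omega> = x j})"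
    by simp
  also have "\<dots> = (\<Sum>x\<in>J \<rightarrow>\<^sub>E T. prob (A \<inter> {\<omega>\<in>space M. \<forall>j\<in>J. X j \<omega> = x j}))"
  proof (rule finite_measure_finite_Union)
    show "finite (J \<rightarrow>\<^sub>E T)" using assms(1,2) by (simp add: finite_PiE)
    show "disjoint_family_on (\<lambda>x. A \<inter> {\<omega>\<in>space M. \<forall>j\<in>J. X j \<omega> = x j}) (J \<rightarrow>\<^sub>E T)"
      unfolding disjoint_family_on_def
    proof (intro ballI impI)
      fix x y assume "x \<in> J \<rightarrow>\<^sub>E T" "y \<in> J \<rightarrow>\<^sub>E T" "x \<noteq> y"
      then obtain j where "j \<in> J" "x j \<noteq> y j" using PiE_ext by metis
      then show "(A \<inter> {\<omega>\<in>space M. \<forall>j\<in>J. X j \<omega> = x j}) \<inter>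
          (A \<inter> {\<omega>\<in>space M. \<forall>j\<in>J. X j \<omega> = y j}) = {}"
        by auto
    qed
  qed (use A cyl in auto)
  finally show ?thesis .
qed

text \<open>A factor \<open>c\<close> common to all cylinder pieces of \<open>B\<close> survives
  summation. Conditioning on \<open>B\<close> thus reduces to conditioning on complete
  pasts.\<close>

lemma (in prob_space) prob_Int_of_cylinders:
  assumes "finite J" "finite T" "\<And>j. j \<in> J \<Longrightarrow> X j \<in> measurable M (count_space T)"
    and "A \<in> events" "B \<in> events"
    and "\<And>x. x \<in> J \<rightarrow>\<^sub>E T \<Longrightarrow>
      prob (A \<inter> (B \<inter> {\<omega>\<in>space M. \<forall>j\<in>J. X j \<omega> = x j})) =
      c * prob (B \<inter> {\<omega>\<in>space M. \<forall>j\<in>J. X j \<omega> = x j})"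
  shows "prob (A \<inter> B) = c * prob B"
  using prob_eq_sum_cylinders[where X = X and A = "A \<inter> B", OF assms(1-3)]
    prob_eq_sum_cylinders[where X = X and A = B, OF assms(1-3)] assms(4-6)
  by (simp add: sum_distrib_left Int_assoc)

section \<open>The Markov property of the state sequence\<close>

theorem proposition1:
  fixes M :: "('e, 's) sfa"
    and P :: "'\<omega> measure"
    and E :: "'e measure"
    and t :: "nat \<Rightarrow> '\<omega> \<Rightarrow> 'e"
    and K :: "'e set list \<Rightarrow> 'e set \<Rightarrow> real"
    and m n :: nat
  assumes "m \<ge> 1" and "n > m"
    and "wf_sfa M" and "deterministic_sfa M" and "complete_sfa M" and "unambiguous m M"
    and "prob_space P"
    and "space E = event_domain M"
    and "\<And>i. i \<in> {1..n} \<Longrightarrow> t i \<in> measurable P E"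
    and "transition_kernel (words (minterms M) m) (minterms M) K"
    and "markov_process P (minterms M) m 1 n (\<lambda>i \<omega>. minterm_of M (t i \<omega>)) K"
  defines "Y \<equiv> \<lambda>i \<omega>. run M (\<lambda>j. t j \<omega>) i"
  shows "transition_kernel {p \<in> states M. delta_inv M m p \<noteq> {}} (states M) (transition_matrix M m K) \<and>
    (\<forall>i\<in>{m..n}. \<forall>p\<in>states M. \<P>(\<omega> in P. Y i \<omega> = p) > 0 \<longrightarrow> delta_inv M m p \<noteq> {}) \<and>
    markov_process P (states M) 1 m n Y (\<lambda>w. transition_matrix M m K (hd w))"
proof -
  interpret prob_space P by fact
  interpret complete_dfa M using assms(3-5) by unfold_locales
  let ?T = "minterms M"
  define X where "X j \<omega> = minterm_of M (t j \<omega>)" for j \<omega>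
  define cyl where "cyl i x = {\<omega>\<in>space P. \<forall>j\<in>{1..<i}. X j \<omega> = x j}" for i x
  note m = \<open>m \<ge> 1\<close> and unamb = \<open>unambiguous m M\<close>
  have dom: "t j \<omega> \<in> event_domain M" if "\<omega> \<in> space P" "j \<in> {1..n}" for j \<omega>
    using assms(8,9) that by (metis measurable_space)
  have markov: "markov_process P ?T m 1 n X K"
    using assms(11) unfolding X_def .
  then have X_meas: "X j \<in> measurable P (count_space ?T)" if "j \<in> {1..n}" for j
    using that by (simp add: markov_process_def)
  have Y_states: "Y i \<omega> \<in> states M" if "\<omega> \<in> space P" "i \<le> n" for i \<omega>
    unfolding Y_def by (rule run_in_states) (use dom that in auto)
  have Y_Suc: "Y (Suc i) \<omega> = delta_minterm M (Y i \<omega>) (X (Suc i) \<omega>)"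
    if "\<omega> \<in> space P" "Suc i \<le> n" for i \<omega>
  proof -
    have "Y i \<omega> \<in> states M" "t (Suc i) \<omega> \<in> event_domain M"
      using Y_states dom that by auto
    then show ?thesis by (simp add: delta_minterm_of X_def Y_def)
  qed
  have Y_cong: "Y i \<omega> = Y i \<omega>'"
    if "\<omega> \<in> space P" "\<omega>' \<in> space P" "i \<le> n" "\<And>j. j \<in> {1..i} \<Longrightarrow> X j \<omega> = X j \<omega>'" for i \<omega> \<omega>'
    unfolding Y_def by (rule run_cong) (use dom that in \<open>auto simp: X_def\<close>)
  have recent: "map (\<lambda>j. X j \<omega>) [Suc i - m..<Suc i] \<in> delta_inv M m (Y i \<omega>)"
    if "\<omega> \<in> space P" "i \<in> {m..n}" for i \<omega>
    unfolding X_def Y_def by (rule recent_word_in_delta_inv) (use dom that in auto)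
  \<comment> \<open>Induction on time: the current state selects one of finitely many maps
    \<open>delta_minterm M q\<close>, which is applied to the measurable next minterm.\<close>
  have Y_meas: "Y i \<in> measurable P (count_space (states M))" if "i \<le> n" for i
    using that
  proof (induction i)
    case 0
    then show ?case using wf by (simp add: Y_def wf_sfa_def)
  next
    case (Suc i)
    have "(\<lambda>\<omega>. delta_minterm M q (X (Suc i) \<omega>)) \<in> measurable P (count_space (states M))"
      if "q \<in> states M" for q
      using X_meas Suc.prems that delta_minterm_in_states
      by (intro measurable_compose[OF X_meas]) auto
    moreover have "Y i \<in> measurable P (count_space (states M))" using Suc by simp
    ultimately have "(\<lambda>\<omega>. delta_minterm M (Y i \<omega>) (X (Suc i) \<omega>))
        \<in> measurable P (count_space (states M))"
      by (rule measurable_compose_countable'[where I = "states M"])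
        (auto intro: countable_finite finite_states)
    moreover have "Y (Suc i) \<in> measurable P (count_space (states M)) \<longleftrightarrow>
        (\<lambda>\<omega>. delta_minterm M (Y i \<omega>) (X (Suc i) \<omega>)) \<in> measurable P (count_space (states M))"
      by (rule measurable_cong) (rule Y_Suc[OF _ Suc.prems])
    ultimately show ?case by blast
  qed
  \<comment> \<open>\<open>B\<close> will be a history of states ending in \<open>p\<close>.
    \<open>B_sat\<close> says that it is a union of cylinders of X_1, ..., X_i. The product form
    also covers null events.\<close>
  have step: "prob ({\<omega>\<in>space P. Y (Suc i) \<omega> = q} \<inter> B) = transition_matrix M m K p q * prob B"
    if i: "i \<in> {m..<n}" and B: "B \<in> events"
      and Bp: "\<And>\<omega>. \<omega> \<in> B \<Longrightarrow> Y i \<omega> = p"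
      and B_sat: "\<And>\<omega> \<omega>'. \<omega> \<in> B \<Longrightarrow> \<omega>' \<in> space P \<Longrightarrow>
        (\<And>j. j \<in> {1..<Suc i} \<Longrightarrow> X j \<omega> = X j \<omega>') \<Longrightarrow> \<omega>' \<in> B"
    for i p q B
  proof (rule prob_Int_of_cylinders[where J = "{1..<Suc i}" and T = ?T and X = X])
    show "X j \<in> measurable P (count_space ?T)" if "j \<in> {1..<Suc i}" for j
      using X_meas that i by auto
    let ?A = "{\<omega>\<in>space P. Y (Suc i) \<omega> = q}"
    show "?A \<in> events"
      using i by (intro sets_Collect_eq_count_space[OF Y_meas]) auto
    fix x assume x: "x \<in> {1..<Suc i} \<rightarrow>\<^sub>E ?T"
    show "prob (?A \<inter> (B \<inter> {\<omega>\<in>space P. \<forall>j\<in>{1..<Suc i}. X j \<omega> = x j})) =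
      transition_matrix M m K p q * prob (B \<inter> {\<omega>\<in>space P. \<forall>j\<in>{1..<Suc i}. X j \<omega> = x j})"
      unfolding cyl_def[symmetric]
    proof (cases "prob (B \<inter> cyl (Suc i) x) = 0")
      \<comment> \<open>A null past has no prescribed conditional law; both sides vanish by
        monotonicity.\<close>
      case True
      have "B \<inter> cyl (Suc i) x \<in> events"
      proof -
        have "cyl (Suc i) x \<in> events"
          unfolding cyl_def using X_meas i by (intro sets_cylinder[where T = ?T]) auto
        then show ?thesis using B by blast
      qed
      then have "prob (?A \<inter> (B \<inter> cyl (Suc i) x)) \<le> prob (B \<inter> cyl (Suc i) x)"
        by (intro finite_measure_mono) auto
      with True show "prob (?A \<inter> (B \<inter> cyl (Suc i) x)) =
          transition_matrix M m K p q * prob (B \<inter> cyl (Suc i) x)"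
        by (simp add: measure_le_0_iff)
    next
      case False
      then have "B \<inter> cyl (Suc i) x \<noteq> {}" by auto
      \<comment> \<open>One outcome suffices: saturation puts its whole cylinder into
        \<open>B\<close>, and its last \<open>m\<close> minterms, fixed on the cylinder, form the
        word belonging to \<open>p\<close>.\<close>
      then obtain \<omega>0 where \<omega>0: "\<omega>0 \<in> B" "\<omega>0 \<in> cyl (Suc i) x" by blast
      have sp: "\<omega>0 \<in> space P" using \<omega>0 by (simp add: cyl_def)
      have BC: "B \<inter> cyl (Suc i) x = cyl (Suc i) x"
        using B_sat[OF \<omega>0(1)] \<omega>0(2) by (auto simp: cyl_def)
      have p: "p \<in> states M" using Bp[OF \<omega>0(1)] Y_states[OF sp, of i] i by auto
      define w where "w = map x [Suc i - m..<Suc i]"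
      have "w = map (\<lambda>j. X j \<omega>0) [Suc i - m..<Suc i]"
        unfolding w_def using \<omega>0(2) i by (auto simp: cyl_def)
      then have w: "w \<in> delta_inv M m p" using recent[OF sp, of i] Bp[OF \<omega>0(1)] i by auto
      have Y_next: "Y (Suc i) \<omega> = delta_minterm M p (X (Suc i) \<omega>)" "X (Suc i) \<omega> \<in> ?T"
        if "\<omega> \<in> cyl (Suc i) x" for \<omega>
      proof -
        have sp: "\<omega> \<in> space P" using that by (simp add: cyl_def)
        have "Y i \<omega> = p" using that BC Bp by blast
        then show "Y (Suc i) \<omega> = delta_minterm M p (X (Suc i) \<omega>)" using Y_Suc[OF sp] i by auto
        show "X (Suc i) \<omega> \<in> ?T" using measurable_space[OF X_meas sp, of "Suc i"] i by auto
      qed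
      show "prob (?A \<inter> (B \<inter> cyl (Suc i) x)) =
          transition_matrix M m K p q * prob (B \<inter> cyl (Suc i) x)"
        unfolding BC
      proof (cases "q \<in> delta_minterm M p ` ?T")
        case True
        then obtain a where a: "a \<in> ?T" "q = delta_minterm M p a" by blast
        have inj: "inj_on (delta_minterm M p) ?T"
          using inj_on_delta_minterm[OF m unamb p] w by blast
        \<comment> \<open>Injectivity turns the event about the next state into one about the next
          minterm, to which the Markov hypothesis applies.\<close>
        have "Y (Suc i) \<omega> = q \<longleftrightarrow> X (Suc i) \<omega> = a" if "\<omega> \<in> cyl (Suc i) x" for \<omega>
          using Y_next[OF that] a inj by (auto dest: inj_onD)
        then have eq: "?A \<inter> cyl (Suc i) x =
            {\<omega>\<in>space P. X (Suc i) \<omega> = a \<and> (\<forall>j\<in>{1..<Suc i}. X j \<omega> = x j)}"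
          by (auto simp: cyl_def)
        have pos: "prob (cyl (Suc i) x) > 0"
          using False BC by (simp add: zero_less_measure_iff)
        have "\<P>(\<omega> in P. X (Suc i) \<omega> = a \<bar> \<forall>j\<in>{1..<Suc i}. X j \<omega> = x j) = K w a"
        proof -
          \<comment> \<open>The stream starts at index 1, so the kernel governs times from
            \<open>m + 1\<close> on, that is \<open>Suc i\<close> with
            \<open>i \<ge> m\<close>.\<close>
          have "Suc i \<in> {1 + m..n}" "x \<in> {1..<Suc i} \<rightarrow> ?T" using i x by auto
          then show ?thesis
            using markov pos a(1) unfolding markov_process_def cyl_def w_def by blast
        qed
        then have "prob (?A \<inter> cyl (Suc i) x) = K w a * prob (cyl (Suc i) x)"
          using pos unfolding eq unfolding cond_prob_def cyl_def by (simp add: field_simps)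
        then show "prob (?A \<inter> cyl (Suc i) x) =
            transition_matrix M m K p q * prob (cyl (Suc i) x)"
          using transition_matrix_delta_minterm[OF m unamb p w a(1)] a(2) by simp
      next
        case False
        then have "?A \<inter> cyl (Suc i) x = {}" using Y_next by auto
        with False show "prob (?A \<inter> cyl (Suc i) x) =
            transition_matrix M m K p q * prob (cyl (Suc i) x)"
          by (simp add: transition_matrix_def)
      qed
    qed
  qed (use B finite_minterms in auto)
  \<comment> \<open>The start \<open>l\<close> of the history is left free: \<open>l = m\<close>
    gives the full past and \<open>l = i - 1\<close> the last state alone, with the same
    value.\<close>
  have cond: "\<P>(\<omega> in P. Y i \<omega> = q \<bar> \<forall>j\<in>{l..<i}. Y j \<omega> = y j) =
      transition_matrix M m K (y (i - 1)) q"
    if i: "i \<in> {m + 1..n}" and l: "m \<le> l" "l < i"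
      and pos: "\<P>(\<omega> in P. \<forall>j\<in>{l..<i}. Y j \<omega> = y j) > 0"
    for i l q y
  proof -
    obtain k where k: "i = Suc k" "k \<in> {m..<n}" using i by (cases i) auto
    define B where "B = {\<omega>\<in>space P. \<forall>j\<in>{l..<i}. Y j \<omega> = y j}"
    have "prob ({\<omega>\<in>space P. Y (Suc k) \<omega> = q} \<inter> B) = transition_matrix M m K (y k) q * prob B"
    proof (rule step[OF k(2)])
      show "B \<in> events"
        unfolding B_def using Y_meas i by (intro sets_cylinder[where T = "states M"]) auto
      show "Y k \<omega> = y k" if "\<omega> \<in> B" for \<omega>
        using that l k by (auto simp: B_def)
      fix \<omega> \<omega>' assume \<omega>: "\<omega> \<in> B" "\<omega>' \<in> space P"
        "\<And>j. j \<in> {1..<Suc k} \<Longrightarrow> X j \<omega> = X j \<omega>'"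
      \<comment> \<open>Saturation: all states in the history have index at most \<open>k\<close>,
        so agreement of the first \<open>k\<close> minterms fixes them.\<close>
      have "Y j \<omega> = Y j \<omega>'" if "j \<in> {l..<i}" for j
        by (rule Y_cong) (use \<omega> that k in \<open>auto simp: B_def\<close>)
      with \<omega> show "\<omega>' \<in> B" by (simp add: B_def)
    qed
    moreover have "{\<omega>\<in>space P. Y (Suc k) \<omega> = q} \<inter> B =
        {\<omega>\<in>space P. Y i \<omega> = q \<and> (\<forall>j\<in>{l..<i}. Y j \<omega> = y j)}"
      by (auto simp: B_def k)
    ultimately show ?thesis
      using pos unfolding cond_prob_def B_def by (simp add: k field_simps)
  qed
  have "markov_process P (states M) 1 m n Y (\<lambda>w. transition_matrix M m K (hd w))"
    unfolding markov_process_def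
  proof (intro conjI ballI impI)
    show "Y i \<in> measurable P (count_space (states M))" if "i \<in> {m..n}" for i
      using Y_meas that by simp
    fix i y q assume i: "i \<in> {m + 1..n}"
      and pos: "\<P>(\<omega> in P. \<forall>j\<in>{m..<i}. Y j \<omega> = y j) > 0"
    \<comment> \<open>The event fixing only the last state contains the full history, hence it also
      has positive probability.\<close>
    have "{\<omega>\<in>space P. \<forall>j\<in>{i - 1..<i}. Y j \<omega> = y j} \<in> events"
      using Y_meas i by (intro sets_cylinder[where T = "states M"]) auto
    then have "prob {\<omega>\<in>space P. \<forall>j\<in>{m..<i}. Y j \<omega> = y j} \<le>
        prob {\<omega>\<in>space P. \<forall>j\<in>{i - 1..<i}. Y j \<omega> = y j}"
      using i by (intro finite_measure_mono) auto
    then have pos': "\<P>(\<omega> in P. \<forall>j\<in>{i - 1..<i}. Y j \<omega> = y j) > 0" using pos by linarith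
    have one: "\<P>(\<omega> in P. Y i \<omega> = q \<bar> \<forall>j\<in>{m..<i}. Y j \<omega> = y j) =
        transition_matrix M m K (y (i - 1)) q"
      using i by (intro cond[OF i _ _ pos]) auto
    have two: "\<P>(\<omega> in P. Y i \<omega> = q \<bar> \<forall>j\<in>{i - 1..<i}. Y j \<omega> = y j) =
        transition_matrix M m K (y (i - 1)) q"
      using i by (intro cond[OF i _ _ pos']) auto
    show "\<P>(\<omega> in P. Y i \<omega> = q \<bar> \<forall>j\<in>{m..<i}. Y j \<omega> = y j) =
        \<P>(\<omega> in P. Y i \<omega> = q \<bar> \<forall>j\<in>{i - 1..<i}. Y j \<omega> = y j)"
      using one two by simp
    have "hd (map y [i - 1..<i]) = y (i - 1)" using i by (cases i) auto
    then show "\<P>(\<omega> in P. Y i \<omega> = q \<bar> \<forall>j\<in>{m..<i}. Y j \<omega> = y j) =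
        transition_matrix M m K (hd (map y [i - 1..<i])) q"
      using one by simp
  qed
  moreover have "delta_inv M m p \<noteq> {}"
    if "i \<in> {m..n}" and pos: "\<P>(\<omega> in P. Y i \<omega> = p) > 0" for i p
  proof -
    \<comment> \<open>Any outcome in this event supplies a word leading to \<open>p\<close>, namely
      its recent minterms.\<close>
    have "{\<omega>\<in>space P. Y i \<omega> = p} \<noteq> {}" using pos by (metis measure_empty less_irrefl)
    then show ?thesis using recent that(1) by blast
  qed
  ultimately show ?thesis
    by (intro conjI ballI impI transition_matrix_kernel[OF m unamb assms(10)])
qed

end
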